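(* For every integer $n\ge 1$ and every single color $x\in\{r,b,y,g,o,s\}$, \[F(J(T_n(\{x\})),q)=\prod_{j=1}^{n} j!_q=\prod_{1\le i\le j\le k\le n-1}\frac{[i+1]_q}{[i]_q}.\]
   Context: For an integer $n\ge1$, let $T_n$ be the set of triples $(c_1,c_2,c_3)$ of nonnegative integers with $c_1+c_2+c_3\le n-2$. Six colors are associated to vectors: red $r=(1,0,0)$, green $g=(0,1,0)$, yellow $y=(0,0,1)$, blue $b=(-1,1,0)$, orange $o=(-1,0,1)$, silver $s=(0,1,-1)$. For $S\subseteq\{r,b,g,o,y,s\}$, $T_n(S)$ is the poset on $T_n$ whose order relation is the reflexive–transitive closure of the relations $u<u+v$ for all $u,u+v\in T_n$ and $v$ the vector of a color in $S$. $J(P)$ denotes the set of order ideals of a poset $P$ and $F(J(P),q)=\sum_{I\in J(P)}q^{|I|}$. Also $[m]_q=1+q+\dots+q^{m-1}$ and $m!_q=[1]_q[2]_q\cdots[m]_q$. *)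

theory Defs
  imports
    "HOL-Library.Product_Plus"
    "HOL-Computational_Algebra.Computational_Algebra"
begin

text \<open>The bound is stated in \<open>int\<close> because \<open>n - 2 = -1\<close> for \<open>n = 1\<close>, where the set is empty.\<close>

definition T :: "nat \<Rightarrow> (int \<times> int \<times> int) set" where
  "T n = {(c1, c2, c3). 0 \<le> c1 \<and> 0 \<le> c2 \<and> 0 \<le> c3 \<and> c1 + c2 + c3 \<le> int n - 2}"

datatype color = Red | Blue | Yellow | Green | Orange | Silver

fun color_vec :: "color \<Rightarrow> int \<times> int \<times> int" where
  "color_vec Red = (1, 0, 0)"
| "color_vec Green = (0, 1, 0)"
| "color_vec Yellow = (0, 0, 1)"
| "color_vec Blue = (-1, 1, 0)"
| "color_vec Orange = (-1, 0, 1)"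
| "color_vec Silver = (0, 1, -1)"

definition T_step :: "nat \<Rightarrow> color set \<Rightarrow> (int \<times> int \<times> int) rel" where
  "T_step n S = {(u, u + color_vec c) | u c. c \<in> S \<and> u \<in> T n \<and> u + color_vec c \<in> T n}"

text \<open>A pair \<open>(u, w)\<close> in the relation means \<open>u \<le> w\<close>. The intersection only
  removes the pairs \<open>(u, u)\<close> with \<open>u\<close> outside \<open>T n\<close>, which \<open>\<^sup>*\<close> adds.\<close>

definition T_order :: "nat \<Rightarrow> color set \<Rightarrow> (int \<times> int \<times> int) rel" where
  "T_order n S = (T_step n S)\<^sup>* \<inter> (T n \<times> T n)"

text \<open>A positive linear functional on all six color vectors makes the steps acyclic,
  so the relation is indeed a partial order for every set of colors.\<close>

lemma partial_order_on_T_order: "partial_order_on (T n) (T_order n S)"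
proof -
  define h :: "int \<times> int \<times> int \<Rightarrow> int" where "h = (\<lambda>(a, b, c). a + 3 * b + 2 * c)"
  have step: "h u < h w" if "(u, w) \<in> T_step n S" for u w
  proof -
    from that obtain c where w: "w = u + color_vec c" by (auto simp: T_step_def)
    show ?thesis unfolding w by (cases u; cases c) (auto simp: h_def)
  qed
  have "h u \<le> h w \<and> (h u = h w \<longrightarrow> u = w)" if "(u, w) \<in> (T_step n S)\<^sup>*" for u w
    using that by (induction rule: rtrancl_induct) (use step in force)+
  then have "antisym (T_order n S)"
    unfolding antisym_def T_order_def by (metis IntD1 order_antisym)
  moreover have "trans (T_order n S)"
    by (rule transI) (auto simp: T_order_def)
  ultimately show ?thesis
    by (auto simp: partial_order_on_def preorder_on_def refl_on_def T_order_def)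
qed

definition order_ideals :: "'a set \<Rightarrow> 'a rel \<Rightarrow> 'a set set" where
  "order_ideals P r = {I. I \<subseteq> P \<and> (\<forall>w\<in>I. \<forall>u\<in>P. (u, w) \<in> r \<longrightarrow> u \<in> I)}"

text \<open>The variable \<open>q\<close> is the polynomial indeterminate: \<open>monom 1 k\<close> is \<open>q ^ k\<close>.\<close>

definition gen_fun :: "'a set set \<Rightarrow> int poly" where
  "gen_fun J = (\<Sum>I\<in>J. monom 1 (card I))"

definition q_int :: "nat \<Rightarrow> int poly" where
  "q_int m = (\<Sum>k<m. monom 1 k)"

definition q_fact :: "nat \<Rightarrow> int poly" where
  "q_fact m = (\<Prod>k=1..m. q_int k)"

end

theory Submission
  imports Defs
begin

text \<open>
  For a single color the poset is a disjoint union of chains, one of length \<open>j\<close> for each pair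
  \<open>1 \<le> j \<le> k \<le> n - 1\<close>. An order ideal picks an initial segment of each chain independently, so
  the generating function is the product of the \<open>[j + 1]\<^sub>q\<close> over these pairs; for fixed \<open>k\<close> the
  factors multiply to \<open>(k + 1)!\<^sub>q\<close>. In the triple product, the factors with fixed \<open>j\<close> and \<open>k\<close>
  telescope to the same \<open>[j + 1]\<^sub>q\<close>.
\<close>

text \<open>The least number outside the finite set \<open>A\<close> is a cut: everything below it
  lies in \<open>A\<close> by minimality, and a member above it would pull the cut itself into
  \<open>A\<close>. Comparing cardinalities identifies the cut with \<open>card A\<close>.\<close>

lemma downclosed_nat_eq_lessThan:
  fixes A :: "nat set"
  assumes "A \<subseteq> {..<m}" and down: "\<And>i. Suc i \<in> A \<Longrightarrow> i \<in> A"
  shows "A = {..<card A}"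
proof -
  have fin: "finite A"
    using assms(1) finite_subset by blast
  have closed: "i \<in> A" if "j \<in> A" "i \<le> j" for i j
    using that(2,1) by (induction rule: inc_induct) (auto intro: down)
  have "A = {..<h}" if "h = (LEAST i. i \<notin> A)" for h
  proof -
    have "h \<notin> A"
      unfolding that using fin by (metis LeastI ex_new_if_finite infinite_UNIV_nat)
    then show ?thesis
      using closed not_less_Least unfolding that by (auto simp: not_less intro: ccontr)
  qed
  then show ?thesis
    by (metis card_lessThan)
qed

text \<open>\<open>R\<close> links consecutive elements of a chain, and \<open>f\<close> records
  chain and height. Ideals correspond to choices of a cut \<open>h k \<le> l k\<close> in each
  chain, and their size is the sum of the cuts, so the generating function factors.\<close>

lemma gen_fun_chains:
  fixes f :: "'a \<Rightarrow> 'k \<times> nat"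
  assumes "finite K"
    and bij: "bij_betw f P (SIGMA k:K. {..<l k})"
    and step: "\<And>u w. (u, w) \<in> R \<longleftrightarrow>
      u \<in> P \<and> w \<in> P \<and> fst (f w) = fst (f u) \<and> snd (f w) = Suc (snd (f u))"
  shows "gen_fun (order_ideals P (R\<^sup>* \<inter> P \<times> P)) = (\<Prod>k\<in>K. q_int (Suc (l k)))"
proof -
  define C where "C k i = inv_into P f (k, i)" for k i
  have C: "C k i \<in> P" "f (C k i) = (k, i)" if "k \<in> K" "i < l k" for k i
    unfolding C_def using that bij
    by (auto simp: bij_betw_def intro!: inv_into_into f_inv_into_f)
  have C_f: "C (fst (f u)) (snd (f u)) = u" if "u \<in> P" for u
    unfolding C_def using that bij by (simp add: bij_betw_def)
  have f_mem: "fst (f u) \<in> K" "snd (f u) < l (fst (f u))" if "u \<in> P" for u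
    using bij_betw_apply[OF bij that] by auto
  define G where "G h = {u \<in> P. snd (f u) < h (fst (f u))}" for h
  \<comment> \<open>A chain of length \<open>l k\<close> has \<open>l k + 1\<close> cuts, the empty
    and the full one included; hence the \<open>Suc\<close> in the product. \<open>PiE\<close> fixes
    the values outside \<open>K\<close>, so that \<open>G\<close> can be injective.\<close>
  let ?H = "PiE K (\<lambda>k. {..l k})"
  \<comment> \<open>Each \<open>h k\<close> can be read off from \<open>G h\<close>, which gives
    injectivity of \<open>G\<close>.\<close>
  have G_section: "{i. i < l k \<and> C k i \<in> G h} = {..<h k}" if "h \<in> ?H" "k \<in> K" for h k
    using PiE_mem[OF that] C[OF that(2)] by (auto simp: G_def)
  \<comment> \<open>Going up stays in one chain and never lowers the height; hence every
    \<open>G h\<close> is an ideal.\<close>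
  have order: "fst (f w) = fst (f u) \<and> snd (f u) \<le> snd (f w)" if "(u, w) \<in> R\<^sup>*" for u w
    using that by (induction rule: rtrancl_induct) (auto simp: step)
  have "order_ideals P (R\<^sup>* \<inter> P \<times> P) = G ` ?H"
  proof (intro equalityI subsetI)
    fix I assume I: "I \<in> order_ideals P (R\<^sup>* \<inter> P \<times> P)"
    then have IP: "I \<subseteq> P"
      by (auto simp: order_ideals_def)
    \<comment> \<open>The heights at which \<open>I\<close> meets chain \<open>k\<close>; their
      number is the cut.\<close>
    define A where "A k = {i. i < l k \<and> C k i \<in> I}" for k
    define h where "h = restrict (\<lambda>k. card (A k)) K"
    have A: "A k = {..<card (A k)}" if k: "k \<in> K" for k
    proof (rule downclosed_nat_eq_lessThan[of _ "l k"])
      show "A k \<subseteq> {..<l k}"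
        by (auto simp: A_def)
      fix i assume i: "Suc i \<in> A k"
      then have "(C k i, C k (Suc i)) \<in> R\<^sup>* \<inter> P \<times> P"
        using C[OF k] by (auto simp: step A_def intro!: r_into_rtrancl)
      then have "C k i \<in> I"
        using I i unfolding order_ideals_def A_def by blast
      then show "i \<in> A k"
        using i by (auto simp: A_def)
    qed
    have "card (A k) \<le> l k" for k
      using card_mono[of "{..<l k}" "A k"] by (auto simp: A_def)
    then have "h \<in> ?H"
      by (auto simp: h_def)
    moreover have "u \<in> I \<longleftrightarrow> u \<in> G h" if "u \<in> P" for u
    proof -
      have "u \<in> I \<longleftrightarrow> snd (f u) \<in> A (fst (f u))"
        using C_f[OF that] f_mem[OF that] by (simp add: A_def)
      also have "\<dots> \<longleftrightarrow> u \<in> G h"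
        by (subst A) (use that f_mem[OF that] in \<open>auto simp: G_def h_def\<close>)
      finally show ?thesis .
    qed
    then have "I = G h"
      using IP by (auto simp: G_def)
    ultimately show "I \<in> G ` ?H"
      by blast
  next
    fix I assume "I \<in> G ` ?H"
    then show "I \<in> order_ideals P (R\<^sup>* \<inter> P \<times> P)"
      by (fastforce simp: order_ideals_def G_def dest: order)
  qed
  moreover have "inj_on G ?H"
  proof (rule inj_onI)
    fix h h' assume h: "h \<in> ?H" "h' \<in> ?H" "G h = G h'"
    have "h k = h' k" if "k \<in> K" for k
      using G_section[OF h(1) that] G_section[OF h(2) that] h(3) by simp
    then show "h = h'"
      using h(1,2) by (rule PiE_ext[rotated 2])
  qed
  moreover have "card (G h) = (\<Sum>k\<in>K. h k)" if h: "h \<in> ?H" for h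
  proof -
    have "bij_betw f (G h) (SIGMA k:K. {..<h k})"
    proof (rule bij_betw_subset[OF bij])
      show "G h \<subseteq> P"
        by (auto simp: G_def)
      show "f ` G h = (SIGMA k:K. {..<h k})"
      proof (intro equalityI subsetI)
        fix z assume "z \<in> f ` G h"
        then obtain u where "z = f u" "u \<in> P" "snd (f u) < h (fst (f u))"
          by (auto simp: G_def)
        then show "z \<in> (SIGMA k:K. {..<h k})"
          using f_mem(1)[of u] by (cases "f u") auto
      next
        fix z assume "z \<in> (SIGMA k:K. {..<h k})"
        then obtain k i where z: "z = (k, i)" "k \<in> K" "i < h k"
          by auto
        then have "i < l k"
          using PiE_mem[OF h] by fastforce
        then show "z \<in> f ` G h"
          using C[of k i] z by (auto simp: G_def intro!: image_eqI[of _ _ "C k i"])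
      qed
    qed
    then show ?thesis
      using \<open>finite K\<close> by (simp add: bij_betw_same_card)
  qed
  ultimately have "gen_fun (order_ideals P (R\<^sup>* \<inter> P \<times> P)) = (\<Sum>h\<in>?H. monom 1 (\<Sum>k\<in>K. h k))"
    by (simp add: gen_fun_def sum.reindex)
  also have "\<dots> = (\<Sum>h\<in>?H. \<Prod>k\<in>K. monom 1 (h k))"
    by (simp add: monom_altdef power_sum)
  \<comment> \<open>Distributivity: expanding the product chooses one exponent per chain.\<close>
  also have "\<dots> = (\<Prod>k\<in>K. \<Sum>i\<le>l k. monom 1 i)"
    using \<open>finite K\<close> by (simp add: prod_sum_PiE)
  finally show ?thesis
    by (simp add: q_int_def lessThan_Suc_atMost)
qed

text \<open>
  \<open>chain_coord n x u = ((k, j), i)\<close> says that \<open>u\<close> is the element at height \<open>i\<close> of the chain with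
  index \<open>(k, j)\<close>; the length of this chain is \<open>j\<close>.
\<close>

fun chain_coord :: "nat \<Rightarrow> color \<Rightarrow> int \<times> int \<times> int \<Rightarrow> (nat \<times> nat) \<times> nat" where
  "chain_coord n Red (a, b, c) = ((nat (int n - 1 - c), nat (int n - 1 - b - c)), nat a)"
| "chain_coord n Green (a, b, c) = ((nat (int n - 1 - c), nat (int n - 1 - a - c)), nat b)"
| "chain_coord n Yellow (a, b, c) = ((nat (int n - 1 - b), nat (int n - 1 - a - b)), nat c)"
| "chain_coord n Blue (a, b, c) = ((nat (a + b + c + 1), nat (a + b + 1)), nat b)"
| "chain_coord n Orange (a, b, c) = ((nat (a + b + c + 1), nat (a + c + 1)), nat c)"
| "chain_coord n Silver (a, b, c) = ((nat (a + b + c + 1), nat (b + c + 1)), nat b)"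

text \<open>Inverse of \<open>chain_coord\<close> on the index range. For red, green and yellow one
  coordinate moves and the other two label the chain; for blue, orange and silver a unit passes
  between two coordinates, so their sum and the third coordinate are invariant.\<close>

fun chain_point :: "nat \<Rightarrow> color \<Rightarrow> (nat \<times> nat) \<times> nat \<Rightarrow> int \<times> int \<times> int" where
  "chain_point n Red ((k, j), i) = (int i, int k - int j, int n - 1 - int k)"
| "chain_point n Green ((k, j), i) = (int k - int j, int i, int n - 1 - int k)"
| "chain_point n Yellow ((k, j), i) = (int k - int j, int n - 1 - int k, int i)"
| "chain_point n Blue ((k, j), i) = (int j - 1 - int i, int i, int k - int j)"
| "chain_point n Orange ((k, j), i) = (int j - 1 - int i, int k - int j, int i)"
| "chain_point n Silver ((k, j), i) = (int k - int j, int i, int j - 1 - int i)"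

lemma chain_point_coord: "u \<in> T n \<Longrightarrow> chain_point n x (chain_coord n x u) = u"
  by (cases x) (auto simp: T_def)

text \<open>Under the change of coordinates, \<open>0 \<le> i\<close>, \<open>i < j\<close>,
  \<open>j \<le> k\<close> and \<open>k \<le> n - 1\<close> become the four inequalities defining
  \<open>T n\<close>. For \<open>n \<le> 1\<close> both sides are empty.\<close>

lemma bij_betw_chain_coord:
  "bij_betw (chain_coord n x) (T n) (SIGMA p:(SIGMA k:{1..n - 1}. {1..k}). {..<snd p})"
proof (rule bij_betw_byWitness[where f' = "chain_point n x"])
  show "\<forall>u\<in>T n. chain_point n x (chain_coord n x u) = u"
    by (simp add: chain_point_coord)
  show "\<forall>z\<in>(SIGMA p:(SIGMA k:{1..n - 1}. {1..k}). {..<snd p}).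
      chain_coord n x (chain_point n x z) = z"
    by (cases x) auto
  show "chain_coord n x ` T n \<subseteq> (SIGMA p:(SIGMA k:{1..n - 1}. {1..k}). {..<snd p})"
    by (cases x) (auto simp: T_def)
  show "chain_point n x ` (SIGMA p:(SIGMA k:{1..n - 1}. {1..k}). {..<snd p}) \<subseteq> T n"
    by (cases x) (auto simp: T_def)
qed

lemma chain_coord_add_color_vec:
  "u \<in> T n \<Longrightarrow> chain_coord n x (u + color_vec x) =
    (fst (chain_coord n x u), Suc (snd (chain_coord n x u)))"
  by (cases u; cases x) (simp_all add: T_def algebra_simps Suc_nat_eq_nat_zadd1)

lemma chain_point_Suc: "chain_point n x (p, Suc i) = chain_point n x (p, i) + color_vec x"
  by (cases p; cases x) simp_all

lemma T_step_singleton_iff: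
  "(u, w) \<in> T_step n {x} \<longleftrightarrow> u \<in> T n \<and> w \<in> T n \<and>
    fst (chain_coord n x w) = fst (chain_coord n x u) \<and>
    snd (chain_coord n x w) = Suc (snd (chain_coord n x u))"
proof -
  have "(u, w) \<in> T_step n {x} \<longleftrightarrow> u \<in> T n \<and> w \<in> T n \<and> w = u + color_vec x"
    by (cases u) (auto simp: T_step_def)
  \<comment> \<open>Coordinates determine points of \<open>T n\<close>, and raising the height by
    one adds the color vector.\<close>
  moreover have "w = u + color_vec x"
    if "u \<in> T n" "w \<in> T n" "fst (chain_coord n x w) = fst (chain_coord n x u)"
      "snd (chain_coord n x w) = Suc (snd (chain_coord n x u))"
    by (metis that chain_point_coord chain_point_Suc prod.collapse)
  ultimately show ?thesis
    using chain_coord_add_color_vec[of u n x] by auto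
qed

lemma q_fact_Suc: "q_fact (Suc m) = (\<Prod>j=1..m. q_int (j + 1))"
proof (induction m)
  case 0
  show ?case by (simp add: q_fact_def q_int_def)
next
  case (Suc m)
  then show ?case by (simp add: q_fact_def)
qed

text \<open>The factor \<open>q_fact 1\<close> equals 1, so the index can be shifted by one.\<close>

lemma prod_q_fact: "(\<Prod>j=1..n. q_fact j) = (\<Prod>k=1..n - 1. \<Prod>j=1..k. q_int (j + 1))"
proof (cases n)
  case (Suc m)
  have "(\<Prod>j=1..Suc m. q_fact j) = (\<Prod>k=1..m. q_fact (Suc k))"
  proof (induction m)
    case 0
    show ?case by (simp add: q_fact_def q_int_def)
  qed simp
  then show ?thesis
    by (simp only: Suc q_fact_Suc diff_Suc_1)
qed simp

text \<open>The constant coefficient is 1. Nonvanishing permits the telescoping cancellation in the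
  fraction field.\<close>

lemma q_int_nonzero: "m > 0 \<Longrightarrow> q_int m \<noteq> 0"
proof -
  assume "m > 0"
  then have "coeff (q_int m) 0 = 1"
    by (simp add: q_int_def coeff_sum)
  then show ?thesis
    by auto
qed

lemma prod_q_int_ratio:
  "(\<Prod>i=1..j. to_fract (q_int (i + 1)) / to_fract (q_int i)) = to_fract (q_int (j + 1))"
proof (induction j)
  case 0
  show ?case by (simp add: q_int_def)
next
  case (Suc j)
  then show ?case
    by (simp add: q_int_nonzero)
qed

lemma to_fract_prod: "to_fract (\<Prod>a\<in>A. f a) = (\<Prod>a\<in>A. to_fract (f a))"
  by (induction A rule: infinite_finite_induct) auto

theorem theorem2p5:
  fixes n :: nat and x :: color
  assumes "n \<ge> 1"
  shows "gen_fun (order_ideals (T n) (T_order n {x})) = (\<Prod>j=1..n. q_fact j)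
    \<and> to_fract (\<Prod>j=1..n. q_fact j) =
        (\<Prod>(i, j, k)\<in>{(i, j, k). 1 \<le> i \<and> i \<le> j \<and> j \<le> k \<and> k \<le> n - 1}.
          to_fract (q_int (i + 1)) / to_fract (q_int i))"
proof
  have "gen_fun (order_ideals (T n) (T_order n {x})) =
      (\<Prod>p\<in>(SIGMA k:{1..n - 1}. {1..k}). q_int (Suc (snd p)))"
    unfolding T_order_def
    by (rule gen_fun_chains[OF _ bij_betw_chain_coord T_step_singleton_iff]) auto
  also have "\<dots> = (\<Prod>k=1..n - 1. \<Prod>j=1..k. q_int (j + 1))"
    by (subst prod.Sigma) (auto simp: case_prod_beta)
  finally show "gen_fun (order_ideals (T n) (T_order n {x})) = (\<Prod>j=1..n. q_fact j)"
    by (simp only: prod_q_fact)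
next
  let ?r = "\<lambda>i. to_fract (q_int (i + 1)) / to_fract (q_int i)"
  have "to_fract (\<Prod>j=1..n. q_fact j) = (\<Prod>k=1..n - 1. \<Prod>j=1..k. \<Prod>i=1..j. ?r i)"
    unfolding prod_q_fact to_fract_prod prod_q_int_ratio ..
  also have "\<dots> = (\<Prod>(k, j, i)\<in>(SIGMA k:{1..n - 1}. SIGMA j:{1..k}. {1..j}). ?r i)"
    by (simp add: prod.Sigma)
  also have "\<dots> =
      (\<Prod>(i, j, k)\<in>{(i, j, k). 1 \<le> i \<and> i \<le> j \<and> j \<le> k \<and> k \<le> n - 1}. ?r i)"
    by (rule prod.reindex_bij_witness[where i = "\<lambda>(i, j, k). (k, j, i)"
          and j = "\<lambda>(k, j, i). (i, j, k)"]) auto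
  finally show "to_fract (\<Prod>j=1..n. q_fact j) =
      (\<Prod>(i, j, k)\<in>{(i, j, k). 1 \<le> i \<and> i \<le> j \<and> j \<le> k \<and> k \<le> n - 1}. ?r i)" .
qed

end
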